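(* Let $a_1,a_2,a_3,b_1,b_2,b_3\in\mathbb{C}$, $\psi=\sum_{k=1}^3(b_k-a_k)$ and $n\in\mathbb{N}_0$. Assume that $a_1-a_3\notin\mathbb{Z}$, that $\Re(1-b_3+a_2+n)>0$ (so that the series below converge), and that none of $2+a_1+a_2-b_1-b_2+n$, $2+a_2+a_3-b_1-b_2+n$, $\psi+a_2-b_1$, $\psi+a_2-b_2$ belongs to $\{0,-1,-2,\dots\}$. Then $$\begin{aligned}&\frac{\Gamma(a_3-a_1)}{\Gamma(b_1-a_1)\Gamma(b_2-a_1)\Gamma(b_3-a_1)\,\Gamma(2+a_1+a_2-b_1-b_2+n)}\;{}_{3}F_{2}\left({1+a_1-b_1,\ 1+a_1-b_2,\ b_3-a_3\atop 1+a_1-a_3,\ 2+a_1+a_2-b_1-b_2+n};1\right)\\&+\frac{\Gamma(a_1-a_3)}{\Gamma(b_1-a_3)\Gamma(b_2-a_3)\Gamma(b_3-a_3)\,\Gamma(2+a_2+a_3-b_1-b_2+n)}\;{}_{3}F_{2}\left({1+a_3-b_1,\ 1+a_3-b_2,\ b_3-a_1\atop 1+a_3-a_1,\ 2+a_2+a_3-b_1-b_2+n};1\right)\\&=\frac{1}{\Gamma(2-\psi+n)\Gamma(\psi+a_2-b_1)\Gamma(\psi+a_2-b_2)}\;{}_{3}F_{2}\left({b_3-a_1,\ b_3-a_3,\ \psi-1-n\atop \psi+a_2-b_1,\ \psi+a_2-b_2};1\right).\end{aligned}$$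
   Context: ${}_3F_2(\alpha_1,\alpha_2,\alpha_3;\beta_1,\beta_2;1)=\sum_{m\ge0}\frac{(\alpha_1)_m(\alpha_2)_m(\alpha_3)_m}{(\beta_1)_m(\beta_2)_m\,m!}$ is the generalized hypergeometric series at unit argument, where $(x)_m=x(x+1)\cdots(x+m-1)$. $1/\Gamma$ is the entire reciprocal gamma function. $\mathbb{N}_0=\{0,1,2,\dots\}$. *)

theory Defs
  imports "HOL-Analysis.Analysis"
begin

definition hyp3F2_term ::
  "complex \<Rightarrow> complex \<Rightarrow> complex \<Rightarrow> complex \<Rightarrow> complex \<Rightarrow> nat \<Rightarrow> complex" where
  "hyp3F2_term \<alpha>\<^sub>1 \<alpha>\<^sub>2 \<alpha>\<^sub>3 \<beta>\<^sub>1 \<beta>\<^sub>2 m =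
     (pochhammer \<alpha>\<^sub>1 m * pochhammer \<alpha>\<^sub>2 m * pochhammer \<alpha>\<^sub>3 m) /
     (pochhammer \<beta>\<^sub>1 m * pochhammer \<beta>\<^sub>2 m * fact m)"

text \<open>
  The value at unit argument is meaningful only if the lower parameters are not non-positive
  integers and the terms are summable.
\<close>

definition hyp3F2_at_1 ::
  "complex \<Rightarrow> complex \<Rightarrow> complex \<Rightarrow> complex \<Rightarrow> complex \<Rightarrow> complex" where
  "hyp3F2_at_1 \<alpha>\<^sub>1 \<alpha>\<^sub>2 \<alpha>\<^sub>3 \<beta>\<^sub>1 \<beta>\<^sub>2 = (\<Sum>m. hyp3F2_term \<alpha>\<^sub>1 \<alpha>\<^sub>2 \<alpha>\<^sub>3 \<beta>\<^sub>1 \<beta>\<^sub>2 m)"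

end

theory Submission
  imports Defs "HOL-Complex_Analysis.Conformal_Mappings"
begin

text \<open>
  Put \<open>A = 1 + a\<^sub>1 - b\<^sub>1\<close>, \<open>B = 1 + a\<^sub>1 - b\<^sub>2\<close>, \<open>C = b\<^sub>3 - a\<^sub>3\<close>, \<open>E = 1 + a\<^sub>1 - a\<^sub>3\<close> and
  \<open>F = 2 + a\<^sub>1 + a\<^sub>2 - b\<^sub>1 - b\<^sub>2 + n\<close>; the integer \<open>n\<close> is absorbed, and the claim is a three-term
  relation for generic \<open>A, B, C, E, F\<close>. For \<open>Re q > 1\<close> the Beta function has the absolutely
  convergent partial fraction expansion \<open>Beta x q = (\<Sum>j. (1 - q)\<^sub>j / j! / (x + j))\<close>. Multiplying
  the expansions of \<open>Beta C (1 - A)\<close> and \<open>Beta (C - E + 1) (E - B)\<close> and splitting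
  \<open>1 / ((C + i) (C - E + 1 + j))\<close> yields the partial fractions of the product, whose residues are
  again Beta values. Replacing \<open>C\<close> by \<open>C + k\<close> and summing against \<open>(1 + C - F)\<^sub>k / k!\<close> turns the
  product into the series on the right-hand side and the two families of simple fractions into the
  series on the left. Analytic continuation removes the restrictions on the real parts.
\<close>

subsection \<open>Growth of the terms of the series\<close>

text \<open>Comparing squares reduces this to \<open>1 + t \<le> exp t\<close> with
  \<open>t = 2 * Re w + (norm w)\<^sup>2\<close>. Having \<open>Re w\<close>, not
  \<open>norm w\<close>, at first order is what later yields the sharp growth exponent.\<close>

lemma norm_one_plus_le_exp: "norm (1 + w) \<le> exp (Re w + (norm w)\<^sup>2 / 2)" for w :: complex
proof (rule power2_le_imp_le)
  have "(norm (1 + w))\<^sup>2 = 1 + (2 * Re w + (norm w)\<^sup>2)"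
    by (simp add: cmod_power2) (simp add: power2_eq_square algebra_simps)
  also have "\<dots> \<le> exp (2 * Re w + (norm w)\<^sup>2)"
    by (rule exp_ge_add_one_self)
  also have "\<dots> = (exp (Re w + (norm w)\<^sup>2 / 2))\<^sup>2"
    by (simp flip: exp_of_nat_mult add: algebra_simps exp_double)
  finally show "(norm (1 + w))\<^sup>2 \<le> (exp (Re w + (norm w)\<^sup>2 / 2))\<^sup>2" .
qed simp

text \<open>Telescoping: \<open>ln t \<le> t - 1\<close> at the quotient of consecutive integers
  bounds each reciprocal by a difference of logarithms.\<close>

lemma harm_le_ln: "harm (Suc n) \<le> ln (real (Suc n)) + 1"
proof (induction n)
  case (Suc n)
  have "ln (real (Suc n) / real (Suc (Suc n))) \<le> real (Suc n) / real (Suc (Suc n)) - 1"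
    by (rule ln_le_minus_one) simp
  also have "\<dots> = - (1 / real (Suc (Suc n)))"
    by (simp add: field_simps)
  finally have "1 / real (Suc (Suc n)) \<le> ln (real (Suc (Suc n))) - ln (real (Suc n))"
    by (simp add: ln_div)
  moreover have "harm (Suc (Suc n)) = harm (Suc n) + 1 / real (Suc (Suc n))"
    by (simp add: harm_Suc[of "Suc n"] inverse_eq_divide)
  ultimately show ?case using Suc.IH by linarith
qed (simp add: harm_def)

text \<open>Each factor \<open>x + i\<close> is \<open>(i + 1) * (1 + (x - 1) / (i + 1))\<close>.
  Applying the exponential bound factor by factor, the first-order terms add up to a harmonic number
  and the second-order terms to a partial sum of the inverse squares.\<close>

lemma norm_pochhammer_le_exp:
  fixes x :: complex
  shows "norm (pochhammer x m) \<le>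
    fact m * exp (Re (x - 1) * harm m + (norm (x - 1))\<^sup>2 / 2 * (\<Sum>i<m. 1 / (real i + 1)\<^sup>2))"
proof (induction m)
  case (Suc m)
  let ?w = "(x - 1) / of_nat (Suc m)"
  have "x + of_nat m = of_nat (Suc m) * (1 + ?w)"
    by (simp add: distrib_left del: of_nat_Suc) simp
  hence "norm (x + of_nat m) = real (Suc m) * norm (1 + ?w)"
    by (metis norm_mult norm_of_nat)
  also have "\<dots> \<le> real (Suc m) * exp (Re ?w + (norm ?w)\<^sup>2 / 2)"
    by (intro mult_left_mono norm_one_plus_le_exp) simp
  also have "Re ?w = Re (x - 1) * inverse (real (Suc m))"
    by (simp only: Re_divide_of_nat) (simp only: divide_inverse)
  also have "(norm ?w)\<^sup>2 / 2 = (norm (x - 1))\<^sup>2 / 2 * (1 / (real m + 1)\<^sup>2)"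
    by (simp add: norm_divide power_divide add.commute flip: of_nat_Suc)
  finally have "norm (pochhammer x (Suc m)) \<le>
     (fact m * exp (Re (x - 1) * harm m + (norm (x - 1))\<^sup>2 / 2 * (\<Sum>i<m. 1 / (real i + 1)\<^sup>2))) *
     (real (Suc m) * exp (Re (x - 1) * inverse (real (Suc m)) + (norm (x - 1))\<^sup>2 / 2 * (1 / (real m + 1)\<^sup>2)))"
    unfolding pochhammer_Suc norm_mult by (intro mult_mono Suc.IH) auto
  also have "\<dots> = fact (Suc m) * exp (Re (x - 1) * harm (Suc m) + (norm (x - 1))\<^sup>2 / 2 * (\<Sum>i<Suc m. 1 / (real i + 1)\<^sup>2))"
    by (simp add: harm_Suc exp_add [symmetric] algebra_simps exp_add)
  finally show ?case .
qed (simp add: harm_def)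

text \<open>The harmonic number is replaced by \<open>ln m\<close> with error at most 1, and the
  inverse squares by their total. The constant depends only on the radius \<open>R\<close>; this
  uniformity gives locally uniform convergence in the upper parameters. The case
  \<open>m = 0\<close> must be excluded because \<open>0 powr y = 0\<close>.\<close>

lemma pochhammer_upper_bound:
  obtains K where "K > 0"
    "\<And>x m. norm (x :: complex) \<le> R \<Longrightarrow> m > 0 \<Longrightarrow>
       norm (pochhammer x m) \<le> K * (fact m * real m powr (Re x - 1))"
proof
  define S where "S = pi\<^sup>2 / 6"
  define K where "K = exp ((R + 1) + (R + 1)\<^sup>2 / 2 * S)"
  show "K > 0" by (simp add: K_def)
  fix x :: complex and m :: nat
  assume x: "norm x \<le> R" and m: "m > 0"
  have R: "norm (x - 1) \<le> R + 1"
    using x norm_triangle_ineq4[of x 1] by simp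
  have "(\<Sum>i<m. 1 / (real i + 1)\<^sup>2) \<le> S"
    unfolding S_def using inverse_squares_sums
    by (intro sum_le_suminf[where I = "{..<m}", THEN order_trans]) (auto simp: sums_iff add.commute)
  moreover have "0 \<le> (\<Sum>i<m. 1 / (real i + 1)\<^sup>2)"
    by (intro sum_nonneg) auto
  ultimately have 1: "(norm (x - 1))\<^sup>2 / 2 * (\<Sum>i<m. 1 / (real i + 1)\<^sup>2) \<le> (R + 1)\<^sup>2 / 2 * S"
    using R by (intro mult_mono divide_right_mono power_mono) auto
  obtain k where k: "m = Suc k" using m by (cases m) auto
  have "\<bar>harm m - ln (real m)\<bar> \<le> 1"
    using harm_le_ln[of k] ln_le_harm[of m] ln_mono[of "real m" "real m + 1"] m unfolding k by linarith
  moreover have "\<bar>Re (x - 1)\<bar> \<le> R + 1"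
    using R abs_Re_le_cmod[of "x - 1"] by linarith
  ultimately have "\<bar>Re (x - 1) * (harm m - ln (real m))\<bar> \<le> (R + 1) * 1"
    unfolding abs_mult by (intro mult_mono) auto
  hence 2: "Re (x - 1) * harm m \<le> (R + 1) + Re (x - 1) * ln (real m)"
    by (simp add: algebra_simps abs_le_iff)
  have "norm (pochhammer x m) \<le> fact m * exp (Re (x - 1) * harm m + (norm (x - 1))\<^sup>2 / 2 * (\<Sum>i<m. 1 / (real i + 1)\<^sup>2))"
    by (rule norm_pochhammer_le_exp)
  also have "\<dots> \<le> fact m * exp (((R + 1) + Re (x - 1) * ln (real m)) + (R + 1)\<^sup>2 / 2 * S)"
    using 1 2 by (intro mult_left_mono) auto
  also have "\<dots> = K * (fact m * real m powr (Re x - 1))"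
    using m by (simp add: K_def powr_def mult.left_commute algebra_simps flip: exp_add)
  finally show "norm (pochhammer x m) \<le> K * (fact m * real m powr (Re x - 1))" .
qed

text \<open>\<open>Gamma_series' x m\<close> is \<open>(m - 1)! * m powr x\<close> over the
  Pochhammer symbol. It converges, so it is eventually bounded by \<open>norm (Gamma x) + 1\<close>,
  which bounds the denominator from below.\<close>

lemma pochhammer_lower_bound:
  fixes x :: complex
  assumes "x \<notin> \<int>\<^sub>\<le>\<^sub>0"
  obtains k where "k > 0"
    "eventually (\<lambda>m. k * (fact m * real m powr (Re x - 1)) \<le> norm (pochhammer x m)) sequentially"
proof
  have "(\<lambda>n. norm (Gamma_series' x n)) \<longlonglongrightarrow> norm (Gamma x)"
    by (intro tendsto_intros Gamma_series'_LIMSEQ)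
  hence "eventually (\<lambda>n. norm (Gamma_series' x n) < norm (Gamma x) + 1) sequentially"
    by (rule order_tendstoD) simp
  thus "eventually (\<lambda>m. inverse (norm (Gamma x) + 1) * (fact m * real m powr (Re x - 1))
          \<le> norm (pochhammer x m)) sequentially"
    using eventually_gt_at_top[of 0]
  proof eventually_elim
    case (elim m)
    have nz: "pochhammer x m \<noteq> 0"
      using assms pochhammer_eq_0_imp_nonpos_Int by blast
    have "fact m * real m powr (Re x - 1) = fact (m - 1) * real m powr Re x"
      using elim(2) by (simp add: powr_diff fact_reduce)
    also have "\<dots> = norm (fact (m - 1) * exp (x * of_real (ln (of_nat m))))"
      using elim(2) by (simp add: norm_mult powr_def mult.commute)
    also have "\<dots> = norm (Gamma_series' x m) * norm (pochhammer x m)"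
      using nz by (simp add: Gamma_series'_def norm_mult norm_divide)
    also have "\<dots> \<le> (norm (Gamma x) + 1) * norm (pochhammer x m)"
      using elim(1) by (intro mult_right_mono) auto
    finally show ?case
      using add_nonneg_pos[OF norm_ge_zero zero_less_one, of "Gamma x"]
      by (simp add: inverse_eq_divide pos_divide_le_eq mult.commute)
  qed
qed (simp add: add_nonneg_pos)

text \<open>The factorials cancel, three against three, and the powers of \<open>m\<close> combine
  to the stated exponent. The upper parameters vary in a disc while the lower ones stay fixed, as is
  the case in the analytic continuation.\<close>

lemma hyp3F2_term_bound:
  fixes e f :: complex
  assumes "e \<notin> \<int>\<^sub>\<le>\<^sub>0" "f \<notin> \<int>\<^sub>\<le>\<^sub>0"
  obtains K where "K > 0"
    "eventually (\<lambda>m. \<forall>a b c. norm a \<le> R \<longrightarrow> norm b \<le> R \<longrightarrow> norm c \<le> R \<longrightarrow>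
       norm (hyp3F2_term a b c e f m) \<le> K * real m powr (Re (a + b + c - e - f) - 1)) sequentially"
proof -
  obtain K where K: "K > 0" "\<And>x m. norm (x :: complex) \<le> R \<Longrightarrow> m > 0 \<Longrightarrow>
       norm (pochhammer x m) \<le> K * (fact m * real m powr (Re x - 1))"
    using pochhammer_upper_bound by blast
  obtain k where k: "k > 0" "eventually (\<lambda>m. k * (fact m * real m powr (Re e - 1)) \<le> norm (pochhammer e m)) sequentially"
    using pochhammer_lower_bound[OF assms(1)] by blast
  obtain l where l: "l > 0" "eventually (\<lambda>m. l * (fact m * real m powr (Re f - 1)) \<le> norm (pochhammer f m)) sequentially"
    using pochhammer_lower_bound[OF assms(2)] by blast
  show ?thesis
  proof
    show "K ^ 3 / (k * l) > 0" using K k l by simp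
    show "eventually (\<lambda>m. \<forall>a b c. norm a \<le> R \<longrightarrow> norm b \<le> R \<longrightarrow> norm c \<le> R \<longrightarrow>
       norm (hyp3F2_term a b c e f m) \<le> K ^ 3 / (k * l) * real m powr (Re (a + b + c - e - f) - 1)) sequentially"
      using k(2) l(2) eventually_gt_at_top[of 0]
    proof eventually_elim
      case (elim m)
      show ?case
      proof (intro allI impI)
        fix a b c :: complex assume R: "norm a \<le> R" "norm b \<le> R" "norm c \<le> R"
        have "norm (hyp3F2_term a b c e f m) \<le>
          ((K * (fact m * real m powr (Re a - 1))) * (K * (fact m * real m powr (Re b - 1))) *
           (K * (fact m * real m powr (Re c - 1)))) /
          ((k * (fact m * real m powr (Re e - 1))) * (l * (fact m * real m powr (Re f - 1))) * fact m)"
          unfolding hyp3F2_term_def norm_mult norm_divide norm_fact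
          using elim k(1) l(1) K(1)
          by (intro frac_le mult_mono K(2) R mult_pos_pos mult_nonneg_nonneg) auto
        also have "\<dots> = K ^ 3 / (k * l) * (real m powr (Re a - 1) * real m powr (Re b - 1) * real m powr (Re c - 1)
            / (real m powr (Re e - 1) * real m powr (Re f - 1)))"
          by (simp add: power3_eq_cube times_divide_times_eq mult_ac)
        also have "real m powr (Re a - 1) * real m powr (Re b - 1) * real m powr (Re c - 1)
            / (real m powr (Re e - 1) * real m powr (Re f - 1)) = real m powr (Re (a + b + c - e - f) - 1)"
          by (simp flip: powr_add powr_diff add: algebra_simps)
        finally show "norm (hyp3F2_term a b c e f m) \<le> K ^ 3 / (k * l) * real m powr (Re (a + b + c - e - f) - 1)" .
      qed
    qed
  qed
qed

section \<open>Convergence of the series and holomorphic dependence on the upper parameters\<close>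

lemma summable_hyp3F2_term:
  assumes "e \<notin> \<int>\<^sub>\<le>\<^sub>0" "f \<notin> \<int>\<^sub>\<le>\<^sub>0" "Re (e + f - a - b - c) > 0"
  shows "summable (hyp3F2_term a b c e f)"
proof -
  define R where "R = Max {norm a, norm b, norm c}"
  obtain K where "eventually (\<lambda>m. \<forall>a b c. norm a \<le> R \<longrightarrow> norm b \<le> R \<longrightarrow> norm c \<le> R \<longrightarrow>
       norm (hyp3F2_term a b c e f m) \<le> K * real m powr (Re (a + b + c - e - f) - 1)) sequentially"
    using hyp3F2_term_bound[OF assms(1,2)] by blast
  hence "eventually (\<lambda>m. norm (hyp3F2_term a b c e f m) \<le> K * real m powr (Re (a + b + c - e - f) - 1)) sequentially"
    by eventually_elim (auto simp: R_def)
  thus ?thesis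
    by (rule summable_comparison_test_ev) (use assms(3) in \<open>auto simp: summable_real_powr_iff\<close>)
qed

text \<open>The terms are polynomials in \<open>z\<close>, since only upper parameters move, and the
  uniform term bound supplies a summable majorant near each point.\<close>

lemma holomorphic_hyp3F2_at_1:
  assumes "e \<notin> \<int>\<^sub>\<le>\<^sub>0" "f \<notin> \<int>\<^sub>\<le>\<^sub>0"
  shows "(\<lambda>z. hyp3F2_at_1 (a - z) (b - z) (c - z) e f)
           holomorphic_on {z. Re (e + f - a - b - c + 3 * z) > 0}"
proof -
  let ?S = "{z. Re (e + f - a - b - c + 3 * z) > 0}"
  let ?t = "\<lambda>m z. hyp3F2_term (a - z) (b - z) (c - z) e f m"
  have op: "open ?S"
    by (intro open_Collect_less continuous_intros)
  obtain g where g: "\<forall>z\<in>?S. ((\<lambda>m. ?t m z) sums g z) \<and> g field_differentiable (at z)"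
  proof (rule series_differentiable_comparison_complex[of ?S "?t"])
    show "open ?S" by (rule op)
    show "?t m field_differentiable (at z)" for m z
    proof -
      have "(\<lambda>z. pochhammer (x - z) m) holomorphic_on UNIV" for x
        unfolding pochhammer_prod by (intro holomorphic_intros)
      hence "?t m holomorphic_on UNIV"
        unfolding hyp3F2_term_def divide_inverse by (intro holomorphic_intros)
      thus ?thesis by (simp add: holomorphic_on_open field_differentiable_def)
    qed
    show "\<exists>d h. 0 < d \<and> summable h \<and> range h \<subseteq> \<real>\<^sub>\<ge>\<^sub>0 \<and>
             (\<forall>\<^sub>F n in sequentially. \<forall>y\<in>ball z d \<inter> ?S. cmod (?t n y) \<le> cmod (h n))" if "z \<in> ?S" for z
    proof -
      \<comment> \<open>The excess at \<open>z\<close> is \<open>6 * d\<close>. Moving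
        \<open>z\<close> by less than \<open>d\<close> lowers it by less than \<open>3 * d\<close>,
        so more than \<open>3 * d\<close> remains on the whole ball, whence the majorant exponent
        \<open>- 1 - 3 * d\<close>.\<close>
      define d where "d = Re (e + f - a - b - c + 3 * z) / 6"
      have d: "d > 0" using that by (simp add: d_def)
      define R where "R = Max {norm a, norm b, norm c} + norm z + d"
      obtain K where K: "K > 0" "eventually (\<lambda>m. \<forall>a b c. norm a \<le> R \<longrightarrow> norm b \<le> R \<longrightarrow> norm c \<le> R \<longrightarrow>
         norm (hyp3F2_term a b c e f m) \<le> K * real m powr (Re (a + b + c - e - f) - 1)) sequentially"
        using hyp3F2_term_bound[OF assms(1,2)] by blast
      define h where "h = (\<lambda>m. complex_of_real (K * real m powr (- 1 - 3 * d)))"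
      have "summable (\<lambda>m. K * real m powr (- 1 - 3 * d))"
        using d by (intro summable_mult) (simp add: summable_real_powr_iff)
      hence "summable h"
        unfolding h_def by (rule summable_of_real)
      moreover have "range h \<subseteq> \<real>\<^sub>\<ge>\<^sub>0"
        using K(1) by (auto simp: h_def)
      moreover have "\<forall>\<^sub>F m in sequentially. \<forall>y\<in>ball z d \<inter> ?S. cmod (?t m y) \<le> cmod (h m)"
        using K(2) eventually_gt_at_top[of 0]
      proof eventually_elim
        case (elim m)
        show ?case
        proof
          fix y assume y: "y \<in> ball z d \<inter> ?S"
          hence zy: "norm (z - y) < d" by (simp add: dist_norm)
          have R: "norm (x - y) \<le> R" if "x \<in> {a, b, c}" for x
          proof -
            have "norm (x - y) \<le> norm x + norm y" by (rule norm_triangle_ineq4)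
            moreover have "norm y \<le> norm z + d"
              using norm_triangle_ineq4[of z "z - y"] zy by simp
            moreover have "norm x \<le> Max {norm a, norm b, norm c}" using that by auto
            ultimately show ?thesis by (simp add: R_def)
          qed
          have "cmod (?t m y) \<le> K * real m powr (Re ((a - y) + (b - y) + (c - y) - e - f) - 1)"
            by (rule elim(1)[rule_format]) (auto intro: R)
          also have "\<dots> \<le> K * real m powr (- 1 - 3 * d)"
          proof (intro mult_left_mono powr_mono)
            have "Re (z - y) < d"
              using zy complex_Re_le_cmod[of "z - y"] by linarith
            thus "Re ((a - y) + (b - y) + (c - y) - e - f) - 1 \<le> - 1 - 3 * d"
              by (simp add: d_def field_simps)
          qed (use elim K(1) in auto)
          also have "\<dots> = cmod (h m)" using K(1) by (simp add: h_def norm_mult)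
          finally show "cmod (?t m y) \<le> cmod (h m)" .
        qed
      qed
      ultimately show ?thesis using d by blast
    qed
  qed blast
  have "g holomorphic_on ?S"
    using g op by (auto simp: holomorphic_on_open field_differentiable_def)
  thus ?thesis
    by (rule holomorphic_transform) (use g in \<open>auto simp: hyp3F2_at_1_def sums_iff\<close>)
qed

subsection \<open>Partial fractions of Beta functions\<close>

lemma summable_norm_pochhammer_over_fact:
  fixes a :: complex
  assumes "Re a < 0"
  shows "summable (\<lambda>j. norm (pochhammer a j / fact j))"
proof -
  obtain K where K: "\<And>x m. norm (x :: complex) \<le> norm a \<Longrightarrow> m > 0 \<Longrightarrow>
       norm (pochhammer x m) \<le> K * (fact m * real m powr (Re x - 1))"
    using pochhammer_upper_bound by blast
  have "eventually (\<lambda>m. norm (norm (pochhammer a m / fact m)) \<le> K * real m powr (Re a - 1)) sequentially"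
    using eventually_gt_at_top[of 0]
  proof eventually_elim
    case (elim m)
    thus ?case using K[of a m] by (simp add: norm_divide field_simps)
  qed
  thus ?thesis
    by (rule summable_comparison_test_ev) (use assms in \<open>simp add: summable_real_powr_iff\<close>)
qed

text \<open>Chu-Vandermonde with parameters adding up to 1; equivalently, the coefficients of
  \<open>(1 - z) powr (q - 1)\<close> times \<open>(1 - z) powr (- q)\<close>, which is the
  geometric series.\<close>

lemma sum_pochhammer_complementary:
  fixes q :: "'a :: field_char_0"
  shows "(\<Sum>j\<le>N. pochhammer (1 - q) j / fact j * (pochhammer q (N - j) / fact (N - j))) = 1"
proof -
  have "fact N = (\<Sum>j\<le>N. of_nat (N choose j) * pochhammer (1 - q) j * pochhammer q (N - j))"
    using pochhammer_binomial_sum[of "1 - q" q N] by (simp add: pochhammer_fact)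
  also have "\<dots> = (\<Sum>j\<le>N. fact N * (pochhammer (1 - q) j / fact j * (pochhammer q (N - j) / fact (N - j))))"
    by (intro sum.cong refl) (simp add: binomial_fact)
  finally show ?thesis
    unfolding sum_distrib_left [symmetric] by simp
qed

text \<open>This rational function of \<open>x\<close> is a finite approximant of
  \<open>Beta x q\<close>, up to normalisation. In the induction \<open>x + (N + 1)\<close> is split
  as \<open>(x + j) + (N + 1 - j)\<close>: one part cancels the denominator, the other lowers the
  index of \<open>v\<close> by its recurrence.\<close>

lemma pochhammer_ratio_partial_fractions:
  fixes x q :: "'a :: field_char_0"
  assumes "\<And>j. x + of_nat j \<noteq> 0"
  shows "pochhammer (x + q) N / pochhammer x (Suc N) =
    (\<Sum>j\<le>N. pochhammer (1 - q) j / fact j * (pochhammer q (N - j) / fact (N - j)) / (x + of_nat j))"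
proof (induction N)
  case (Suc N)
  define u where "u = (\<lambda>j. pochhammer (1 - q) j / fact j)"
  define v where "v = (\<lambda>j. pochhammer q j / fact j)"
  define T where "T = (\<lambda>N. \<Sum>j\<le>N. u j * v (N - j) / (x + of_nat j))"
  have v: "of_nat (Suc n) * v (Suc n) = (q + of_nat n) * v n" for n
    by (simp add: v_def pochhammer_Suc field_simps del: of_nat_Suc)
  have 1: "(\<Sum>j\<le>N. u j * v (N - j)) = 1" for N
    unfolding u_def v_def by (rule sum_pochhammer_complementary)
  have "(x + of_nat (Suc N)) * T (Suc N) =
      (\<Sum>j\<le>Suc N. u j * v (Suc N - j) + u j * (of_nat (Suc N - j) * v (Suc N - j)) / (x + of_nat j))"
    unfolding T_def sum_distrib_left
  proof (intro sum.cong refl)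
    fix j assume "j \<in> {..Suc N}"
    hence "x + of_nat (Suc N) = (x + of_nat j) + of_nat (Suc N - j)"
      by (simp add: of_nat_diff)
    thus "(x + of_nat (Suc N)) * (u j * v (Suc N - j) / (x + of_nat j)) =
            u j * v (Suc N - j) + u j * (of_nat (Suc N - j) * v (Suc N - j)) / (x + of_nat j)"
      using assms[of j] by (simp only:) (simp add: field_simps)
  qed
  also have "\<dots> = 1 + (\<Sum>j\<le>Suc N. u j * (of_nat (Suc N - j) * v (Suc N - j)) / (x + of_nat j))"
    by (simp only: sum.distrib 1)
  also have "\<dots> = 1 + (\<Sum>j\<le>N. u j * (of_nat (Suc N - j) * v (Suc N - j)) / (x + of_nat j))"
    by simp
  \<comment> \<open>The constant 1 is written as the complementary sum at level \<open>N\<close>, so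
    that it merges termwise with the other sum.\<close>
  also have "\<dots> = (\<Sum>j\<le>N. u j * v (N - j)) + (\<Sum>j\<le>N. u j * ((q + of_nat (N - j)) * v (N - j)) / (x + of_nat j))"
    unfolding 1 by (intro arg_cong2[where f = "(+)"] sum.cong refl) (simp only: Suc_diff_le v atMost_iff)
  also have "\<dots> = (x + q + of_nat N) * T N"
    unfolding T_def sum_distrib_left sum.distrib [symmetric]
  proof (intro sum.cong refl)
    fix j assume "j \<in> {..N}"
    hence "x + q + of_nat N = (x + of_nat j) + (q + of_nat (N - j))"
      by (simp add: of_nat_diff)
    thus "u j * v (N - j) + u j * ((q + of_nat (N - j)) * v (N - j)) / (x + of_nat j) =
            (x + q + of_nat N) * (u j * v (N - j) / (x + of_nat j))"
      using assms[of j] by (simp only:) (simp add: field_simps)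
  qed
  also have "T N = pochhammer (x + q) N / pochhammer x (Suc N)"
    unfolding T_def u_def v_def Suc.IH ..
  finally have "(x + of_nat (Suc N)) * T (Suc N) =
      (x + q + of_nat N) * (pochhammer (x + q) N / pochhammer x (Suc N))" .
  hence "T (Suc N) = (x + q + of_nat N) * (pochhammer (x + q) N / pochhammer x (Suc N)) / (x + of_nat (Suc N))"
    by (metis assms nonzero_mult_div_cancel_left)
  hence "T (Suc N) = pochhammer (x + q) (Suc N) / pochhammer x (Suc (Suc N))"
    unfolding pochhammer_Suc[of _ "Suc N"] pochhammer_Suc[of "x + q"]
    by (simp add: mult_ac del: of_nat_Suc)
  thus ?case by (simp add: T_def u_def v_def)
qed simp

lemma of_nat_ratio_tendsto_1:
  fixes a b :: "'a :: {real_normed_field}"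
  shows "(\<lambda>n. (a + of_nat n) / (b + of_nat n)) \<longlonglongrightarrow> 1"
proof -
  have inf: "filterlim (\<lambda>n. b + of_nat n) at_infinity sequentially"
    by (intro tendsto_add_filterlim_at_infinity[OF tendsto_const] tendsto_of_nat)
  have "(\<lambda>n. 1 + (a - b) / (b + of_nat n)) \<longlonglongrightarrow> 1 + 0"
    by (intro tendsto_add tendsto_const tendsto_divide_0[OF tendsto_const inf])
  moreover have "eventually (\<lambda>n. b + of_nat n \<noteq> 0) sequentially"
    using inf by (rule filterlim_at_infinity_imp_eventually_ne)
  hence "eventually (\<lambda>n. 1 + (a - b) / (b + of_nat n) = (a + of_nat n) / (b + of_nat n)) sequentially"
    by eventually_elim (simp add: field_simps)
  ultimately show ?thesis
    by (simp add: tendsto_cong)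
qed

lemma add_of_nat_neq_0: "x \<notin> \<int>\<^sub>\<le>\<^sub>0 \<Longrightarrow> x + of_nat n \<noteq> (0 :: complex)"
  by (auto simp: add_eq_0_iff2)

text \<open>This is the limit of a quotient of \<open>rGamma_series\<close> approximants, in which
  the powers of \<open>N\<close> cancel. Those approximants carry \<open>N + 1\<close> factors each;
  the extra quotient, tending to 1, removes the last factor for \<open>x + q\<close> and for
  \<open>q\<close>.\<close>

lemma pochhammer_ratio_tendsto_Beta:
  fixes x q :: complex
  assumes x: "x \<notin> \<int>\<^sub>\<le>\<^sub>0" and q: "q \<notin> \<int>\<^sub>\<le>\<^sub>0"
  shows "(\<lambda>N. pochhammer (x + q) N * fact N / (pochhammer x (Suc N) * pochhammer q N)) \<longlonglongrightarrow> Beta x q"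
proof (rule Lim_transform_eventually)
  show "(\<lambda>N. rGamma_series (x + q) N / (rGamma_series x N * rGamma_series q N) *
          ((q + of_nat N) / (x + q + of_nat N))) \<longlonglongrightarrow> Beta x q"
    (is "?f \<longlonglongrightarrow> _")
  proof -
    have "?f \<longlonglongrightarrow> rGamma (x + q) / (rGamma x * rGamma q) * 1"
      using x q by (intro tendsto_intros of_nat_ratio_tendsto_1) (auto simp: rGamma_eq_zero_iff)
    thus ?thesis by (simp add: Beta_def Gamma_def divide_inverse mult_ac)
  qed
  have "eventually (\<lambda>N. x + q + of_nat N \<noteq> 0) sequentially"
    by (rule filterlim_at_infinity_imp_eventually_ne
             [OF tendsto_add_filterlim_at_infinity[OF tendsto_const tendsto_of_nat]])
  thus "eventually (\<lambda>N. rGamma_series (x + q) N / (rGamma_series x N * rGamma_series q N) *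
          ((q + of_nat N) / (x + q + of_nat N)) =
        pochhammer (x + q) N * fact N / (pochhammer x (Suc N) * pochhammer q N)) sequentially"
  proof eventually_elim
    case (elim N)
    define X Y Z where "X = pochhammer x (Suc N)" and "Y = x + q + of_nat N" and "Z = q + of_nat N"
    have nz: "X \<noteq> 0" "pochhammer q N \<noteq> 0" "Y \<noteq> 0" "Z \<noteq> 0"
      using x q pochhammer_eq_0_imp_nonpos_Int elim add_of_nat_neq_0[OF q, of N]
      by (auto simp: X_def Y_def Z_def)
    have "pochhammer (x + q) (N + 1) = pochhammer (x + q) N * Y" "pochhammer q (N + 1) = pochhammer q N * Z"
         "pochhammer x (N + 1) = X"
      by (simp_all add: X_def Y_def Z_def pochhammer_Suc)
    thus ?case
      unfolding rGamma_series_def X_def [symmetric] Y_def [symmetric] Z_def [symmetric] distrib_right exp_add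
      using nz by (simp add: field_simps)
  qed
qed

text \<open>
  The finite expansion at level \<open>N\<close>, divided by \<open>(q)\<^sub>N / N!\<close>, carries weights that tend to 1 and are
  bounded by 1 because \<open>Re q \<ge> 1\<close>; hence Tannery's theorem applies.
\<close>

lemma Beta_series:
  fixes x q :: complex
  assumes x: "x \<notin> \<int>\<^sub>\<le>\<^sub>0" and q: "Re q > 1"
  shows "(\<lambda>j. pochhammer (1 - q) j / fact j / (x + of_nat j)) sums Beta x q"
    and "summable (\<lambda>j. norm (pochhammer (1 - q) j / fact j / (x + of_nat j)))"
proof -
  define u where "u = (\<lambda>j. pochhammer (1 - q) j / fact j / (x + of_nat j))"
  define v where "v = (\<lambda>j. pochhammer q j / fact j)"
  define T where "T = (\<lambda>j N. if j \<le> N then u j * (v (N - j) / v N) else 0)"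
  have q0: "q \<notin> \<int>\<^sub>\<le>\<^sub>0" using q by (auto elim!: nonpos_Ints_cases)
  have v0: "v n \<noteq> 0" for n
    using q0 pochhammer_eq_0_imp_nonpos_Int by (auto simp: v_def)
  have v_Suc: "v (Suc n) = (q + of_nat n) / (1 + of_nat n) * v n" for n
    by (simp add: v_def pochhammer_Suc)
  have "norm (v n) \<le> norm (v (Suc n))" for n
  proof -
    have "norm (1 + of_nat n :: complex) = 1 + real n"
      by (metis norm_of_nat of_nat_Suc)
    also have "\<dots> \<le> norm (q + of_nat n)"
      using q complex_Re_le_cmod[of "q + of_nat n"] by simp
    finally have "1 \<le> norm ((q + of_nat n) / (1 + of_nat n))"
      by (simp add: norm_divide le_divide_eq flip: of_nat_Suc)
    thus ?thesis
      unfolding v_Suc norm_mult by (metis mult_right_mono mult_1 norm_ge_zero)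
  qed
  hence v_mono: "norm (v m) \<le> norm (v n)" if "m \<le> n" for m n
    using that by (rule lift_Suc_mono_le)
  have "(\<lambda>n. v n / v (n + j)) \<longlonglongrightarrow> 1" for j
  proof (induction j)
    case (Suc j)
    have "(\<lambda>n. (1 + of_nat (n + j)) / (q + of_nat (n + j))) \<longlonglongrightarrow> (1 :: complex)"
      using LIMSEQ_ignore_initial_segment[OF of_nat_ratio_tendsto_1] .
    from tendsto_mult[OF Suc.IH this] show ?case
      using v0 by (simp add: v_Suc divide_simps mult_ac)
  qed (simp add: v0)
  hence lim: "(\<lambda>N. T j N) \<longlonglongrightarrow> u j" for j
  proof -
    \<comment> \<open>With \<open>N = n + j\<close> the truncated subtraction and the case
      distinction in \<open>T\<close> disappear.\<close>
    have "(\<lambda>n. u j * (v n / v (n + j))) \<longlonglongrightarrow> u j * 1"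
      by (intro tendsto_intros) fact
    hence "(\<lambda>n. T j (n + j)) \<longlonglongrightarrow> u j"
      by (simp add: T_def)
    thus ?thesis by (rule LIMSEQ_offset)
  qed
  have bound: "norm (T j N) \<le> norm (u j)" for j N
  proof -
    have "norm (v (N - j) / v N) \<le> 1"
      using v_mono[of "N - j" N] v0[of N] by (simp add: norm_divide)
    hence "norm (u j) * norm (v (N - j) / v N) \<le> norm (u j)"
      by (intro mult_left_le) auto
    thus ?thesis unfolding norm_mult [symmetric] by (auto simp: T_def)
  qed
  have "eventually (\<lambda>n. norm (x + of_nat n) \<ge> 1) sequentially"
    using tendsto_add_filterlim_at_infinity[OF tendsto_const tendsto_of_nat, of x]
    by (auto simp: filterlim_at_infinity[of 0])
  hence "eventually (\<lambda>j. norm (norm (u j)) \<le> norm (pochhammer (1 - q) j / fact j)) sequentially"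
  proof eventually_elim
    case (elim j)
    have "norm (pochhammer (1 - q) j / fact j) / norm (x + of_nat j) \<le> norm (pochhammer (1 - q) j / fact j) / 1"
      using elim by (intro divide_left_mono) auto
    thus ?case by (simp add: u_def norm_divide norm_mult)
  qed
  \<comment> \<open>The coefficients alone are absolutely summable because
    \<open>Re (1 - q) < 0\<close>.\<close>
  hence summ: "summable (\<lambda>j. norm (u j))"
    by (rule summable_comparison_test_ev) (use q in \<open>intro summable_norm_pochhammer_over_fact, simp\<close>)
  have "(\<lambda>N. \<Sum>j. T j N) \<longlonglongrightarrow> (\<Sum>j. u j)"
    using tannerys_theorem[of T u sequentially "\<lambda>j. norm (u j)"] lim bound summ
    by (auto intro: always_eventually)
  moreover have "(\<Sum>j. T j N) = pochhammer (x + q) N * fact N / (pochhammer x (Suc N) * pochhammer q N)" for N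
  proof -
    have "(\<Sum>j. T j N) = (\<Sum>j\<le>N. T j N)"
      by (intro suminf_finite) (auto simp: T_def)
    also have "\<dots> = (\<Sum>j\<le>N. pochhammer (1 - q) j / fact j * v (N - j) / (x + of_nat j)) / v N"
      unfolding sum_divide_distrib by (intro sum.cong) (auto simp: T_def u_def)
    also have "\<dots> = pochhammer (x + q) N / pochhammer x (Suc N) / v N"
      unfolding v_def by (subst pochhammer_ratio_partial_fractions) (auto simp: add_of_nat_neq_0 x)
    finally show ?thesis by (simp add: v_def)
  qed
  ultimately have "(\<Sum>j. u j) = Beta x q"
    using pochhammer_ratio_tendsto_Beta[OF x q0] LIMSEQ_unique by simp
  thus "(\<lambda>j. pochhammer (1 - q) j / fact j / (x + of_nat j)) sums Beta x q"
    using summable_norm_cancel[OF summ] by (simp add: sums_iff u_def)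
  show "summable (\<lambda>j. norm (pochhammer (1 - q) j / fact j / (x + of_nat j)))"
    using summ by (simp add: u_def)
qed

section \<open>Double series and products of Beta functions\<close>

text \<open>Fubini with the majorant \<open>norm (a i) * norm (b j) * K\<close>. The kernels used
  below are reciprocals of integer translates of a fixed number.\<close>

lemma suminf_swap_bounded_kernel:
  fixes a b :: "nat \<Rightarrow> complex" and M :: "nat \<Rightarrow> nat \<Rightarrow> complex"
  assumes a: "summable (\<lambda>i. norm (a i))" and b: "summable (\<lambda>j. norm (b j))"
    and M: "\<And>i j. norm (M i j) \<le> K"
  shows "summable (\<lambda>i. norm (\<Sum>j. a i * b j * M i j))"
    and "summable (\<lambda>j. norm (\<Sum>i. a i * b j * M i j))"
    and "(\<Sum>i. \<Sum>j. a i * b j * M i j) = (\<Sum>j. \<Sum>i. a i * b j * M i j)"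
proof -
  define f where "f = (\<lambda>i j. a i * b j * M i j)"
  have K: "K \<ge> 0" using M[of 0 0] norm_ge_zero[of "M 0 0"] by linarith
  have f_le: "norm (f i j) \<le> norm (a i) * norm (b j) * K" for i j
    unfolding f_def norm_mult using M by (intro mult_left_mono) auto
  have si: "summable (\<lambda>j. norm (f i j))" for i
    by (rule summable_comparison_test'[OF summable_mult2[OF summable_mult[OF b]]])
       (use f_le[of i] in auto)
  have sj: "summable (\<lambda>i. norm (f i j))" for j
    by (rule summable_comparison_test'[OF summable_mult2[OF summable_mult2[OF a]]])
       (use f_le[of _ j] in auto)
  have ni: "norm (\<Sum>j. norm (f i j)) \<le> norm (a i) * (\<Sum>j. norm (b j)) * K" for i
  proof -
    have "(\<Sum>j. norm (f i j)) \<le> (\<Sum>j. norm (a i) * norm (b j) * K)"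
      by (intro suminf_le f_le si summable_mult2 summable_mult b)
    also have "\<dots> = norm (a i) * (\<Sum>j. norm (b j)) * K"
      using b by (simp add: suminf_mult suminf_mult2[symmetric] summable_mult)
    finally show ?thesis by (simp add: suminf_nonneg si)
  qed
  have nj: "(\<Sum>i. norm (f i j)) \<le> (\<Sum>i. norm (a i)) * norm (b j) * K" for j
  proof -
    have "(\<Sum>i. norm (f i j)) \<le> (\<Sum>i. norm (a i) * norm (b j) * K)"
      by (intro suminf_le f_le sj summable_mult2 a)
    also have "\<dots> = (\<Sum>i. norm (a i)) * norm (b j) * K"
      using a by (simp add: suminf_mult2[symmetric] summable_mult2)
    finally show ?thesis .
  qed
  have oi: "summable (\<lambda>i. \<Sum>j. norm (f i j))"
    by (rule summable_comparison_test'[OF summable_mult2[OF summable_mult2[OF a]]]) (rule ni)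
  show 1: "summable (\<lambda>i. norm (\<Sum>j. a i * b j * M i j))"
    by (rule summable_comparison_test'[OF oi]) (simp add: summable_norm si[unfolded f_def] f_def)
  have "norm (norm (\<Sum>i. f i j)) \<le> (\<Sum>i. norm (a i)) * norm (b j) * K" for j
    using summable_norm[OF sj[of j]] nj[of j] by simp
  thus 2: "summable (\<lambda>j. norm (\<Sum>i. a i * b j * M i j))"
    unfolding f_def
    by (rule summable_comparison_test'[OF summable_mult2[OF summable_mult[OF b]]])
  \<comment> \<open>A bridge from ordered to unordered sums, where the exchange is available; it is
    used both for real norms and for complex terms.\<close>
  have infsum_norm: "infsum g UNIV = suminf g" if "summable (\<lambda>n. norm (g n))" for g :: "nat \<Rightarrow> 'b :: banach"
    using norm_summable_imp_has_sum[OF that summable_sums[OF summable_norm_cancel[OF that]]]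
    by (rule infsumI)
  have "(\<lambda>p. norm (case p of (i, j) \<Rightarrow> f i j)) summable_on (UNIV \<times> UNIV)"
    unfolding Infinite_Sum.abs_summable_on_Sigma_iff
  proof (intro conjI ballI)
    show "(\<lambda>j. norm (case (i, j) of (i, j) \<Rightarrow> f i j)) summable_on UNIV" for i
      using si[of i] by (auto intro: norm_summable_imp_summable_on)
    have "(\<Sum>\<^sub>\<infinity>j. norm (f i j)) = (\<Sum>j. norm (f i j))" for i
      using si[of i] by (intro infsum_norm) simp
    thus "(\<lambda>i. norm (\<Sum>\<^sub>\<infinity>j. norm (case (i, j) of (i, j) \<Rightarrow> f i j))) summable_on UNIV"
      by (intro norm_summable_imp_summable_on) (use oi in \<open>simp add: suminf_nonneg si\<close>)
  qed
  hence "(\<lambda>(i, j). f i j) summable_on (UNIV \<times> UNIV)"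
    by (rule abs_summable_summable)
  from infsum_swap_banach[OF this] have "(\<Sum>\<^sub>\<infinity>i. \<Sum>j. f i j) = (\<Sum>\<^sub>\<infinity>j. \<Sum>i. f i j)"
    by (simp add: infsum_norm si sj)
  thus "(\<Sum>i. \<Sum>j. a i * b j * M i j) = (\<Sum>j. \<Sum>i. a i * b j * M i j)"
    using 1 2 by (simp add: infsum_norm f_def)
qed

text \<open>Outside a finite range of \<open>n\<close> the real part of the denominator has modulus
  at least 1. The remaining values are finitely many, and a vanishing denominator contributes
  0.\<close>

lemma inverse_add_int_bounded:
  fixes x :: complex
  obtains K where "\<And>n :: int. norm (1 / (x + of_int n)) \<le> K"
proof -
  define N where "N = \<lceil>\<bar>Re x\<bar>\<rceil> + 1"
  define K where "K = Max (insert 1 ((\<lambda>n. norm (1 / (x + of_int n))) ` {-N..N}))"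
  have "norm (1 / (x + of_int n)) \<le> K" for n :: int
  proof (cases "n \<in> {-N..N}")
    case False
    have "1 \<le> \<bar>Re (x + of_int n)\<bar>"
      using False by (auto simp: N_def) linarith+
    also have "\<dots> \<le> norm (x + of_int n)" by (rule abs_Re_le_cmod)
    finally have "norm (1 / (x + of_int n)) \<le> 1"
      by (simp add: norm_divide divide_le_eq)
    also have "1 \<le> K" by (simp add: K_def)
    finally show ?thesis .
  next
    case True
    thus ?thesis unfolding K_def by (intro Max_ge) auto
  qed
  thus ?thesis using that by blast
qed

lemma not_Ints_diff_of_nat: "x \<notin> \<int> \<Longrightarrow> x - of_nat n \<notin> \<int>" for x :: complex
  by (auto dest: Ints_add[of "x - of_nat n" "of_nat n"])

lemma nonpos_Ints_add_of_nat: "x \<notin> \<int>\<^sub>\<le>\<^sub>0 \<Longrightarrow> x + of_nat n \<notin> \<int>\<^sub>\<le>\<^sub>0" for x :: complex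
  using nonpos_Ints_diff_Nats[of "x + of_nat n" "of_nat n"] by auto

text \<open>The poles of the two expansions differ by \<open>d + j - i\<close>, which never vanishes
  and has bounded reciprocals as \<open>d\<close> is not an integer. Splitting each product of
  simple fractions gives two absolutely convergent double series, whose inner sums are again Beta
  expansions, now at \<open>d - i\<close> and \<open>- d - j\<close>.\<close>

lemma Beta_product_partial_fractions:
  fixes x d q r :: complex
  defines "u \<equiv> \<lambda>i. pochhammer (1 - q) i / fact i" and "v \<equiv> \<lambda>j. pochhammer (1 - r) j / fact j"
  assumes q: "Re q > 1" and r: "Re r > 1" and d: "d \<notin> \<int>" and x: "x \<notin> \<int>\<^sub>\<le>\<^sub>0" and xd: "x + d \<notin> \<int>\<^sub>\<le>\<^sub>0"
  shows "summable (\<lambda>i. norm (u i * Beta (d - of_nat i) r))"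
    and "summable (\<lambda>j. norm (v j * Beta (- d - of_nat j) q))"
    and "Beta x q * Beta (x + d) r =
          (\<Sum>i. u i * Beta (d - of_nat i) r / (x + of_nat i)) +
          (\<Sum>j. v j * Beta (- d - of_nat j) q / (x + d + of_nat j))"
proof -
  define D where "D = (\<lambda>i j. 1 / (d + of_int (int j - int i)))"
  obtain K where "\<And>n :: int. norm (1 / (d + of_int n)) \<le> K"
    using inverse_add_int_bounded by blast
  hence K: "norm (D i j) \<le> K" for i j by (simp only: D_def)
  have u: "summable (\<lambda>i. norm (u i))" and v: "summable (\<lambda>j. norm (v j))"
    unfolding u_def v_def by (intro summable_norm_pochhammer_over_fact; use q r in simp)+
  have dZ: "d + of_int n \<noteq> 0" for n
    using d by (metis Ints_minus Ints_of_int add_eq_0_iff2)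
  have d1: "d - of_nat i \<notin> \<int>\<^sub>\<le>\<^sub>0" "- d - of_nat j \<notin> \<int>\<^sub>\<le>\<^sub>0" for i j
    using not_Ints_diff_of_nat[of d i] not_Ints_diff_of_nat[of "- d" j] d
    by (auto dest: nonpos_Ints_Int)
  have sum_v: "(\<lambda>j. v j * D i j) sums Beta (d - of_nat i) r" for i
    using Beta_series(1)[OF d1(1)[of i] r] by (simp add: v_def D_def algebra_simps)
  \<comment> \<open>The sign arises because \<open>- d - j + i\<close> is the negative of the
    denominator in \<open>D i j\<close>.\<close>
  have sum_u: "(\<lambda>i. u i * D i j) sums - Beta (- d - of_nat j) q" for j
  proof -
    have "- (u i / (- d - of_nat j + of_nat i)) = u i * D i j" for i
    proof -
      have "- d - of_nat j + of_nat i = - (d + of_int (int j - int i))" by simp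
      thus ?thesis unfolding D_def by (simp only: divide_minus_right) simp
    qed
    thus ?thesis
      using sums_minus[OF Beta_series(1)[OF d1(2)[of j] q]] by (simp add: u_def)
  qed
  have inner_v: "(\<Sum>j. u i * v j * D i j) = u i * Beta (d - of_nat i) r" for i
    using sums_mult[OF sum_v[of i], of "u i"] by (simp add: sums_iff mult_ac)
  have inner_u: "(\<Sum>i. u i * v j * D i j) = - (v j * Beta (- d - of_nat j) q)" for j
    using sums_mult[OF sum_u[of j], of "v j"] by (simp add: sums_iff mult_ac)
  note swap = suminf_swap_bounded_kernel[where M = D, OF u v K]
  show su: "summable (\<lambda>i. norm (u i * Beta (d - of_nat i) r))"
    using swap(1) by (simp add: inner_v)
  show sv: "summable (\<lambda>j. norm (v j * Beta (- d - of_nat j) q))"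
    using swap(2) by (simp add: inner_u)
  define S where "S = (\<lambda>i. u i / (x + of_nat i))"
  have S_sums: "S sums Beta x q" and S_summable: "summable (\<lambda>i. norm (S i))"
    using Beta_series[OF x q] by (simp_all add: S_def u_def)
  define T where "T = (\<lambda>j. v j / (x + d + of_nat j))"
  have T_sums: "T sums Beta (x + d) r" and T_summable: "summable (\<lambda>j. norm (T j))"
    using Beta_series[OF xd r] by (simp_all add: T_def v_def)
  \<comment> \<open>With \<open>W\<close> the difference of the denominators,
    \<open>1 / (X * (X + W))\<close> equals \<open>(1 / X - 1 / (X + W)) / W\<close>.\<close>
  have split: "S i * T j = S i * v j * D i j - u i * T j * D i j" for i j
  proof -
    define X W where "X = x + of_nat i" and "W = d + of_int (int j - int i)"
    have Y: "x + d + of_nat j = X + W" by (simp add: X_def W_def)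
    have "X \<noteq> 0" "X + W \<noteq> 0" "W \<noteq> 0"
      using add_of_nat_neq_0[OF x] add_of_nat_neq_0[OF xd] dZ unfolding Y [symmetric]
      by (simp_all only: X_def W_def not_False_eq_True)
    thus ?thesis
      unfolding S_def T_def D_def Y X_def [symmetric] W_def [symmetric]
      by (simp add: divide_simps) (simp add: algebra_simps)
  qed
  have SvD: "(\<lambda>j. S i * v j * D i j) sums (S i * Beta (d - of_nat i) r)" for i
    using sums_mult[OF sum_v[of i], of "S i"] by (simp add: mult_ac)
  have uTD: "(\<lambda>i. u i * T j * D i j) sums - (T j * Beta (- d - of_nat j) q)" for j
    using sums_mult[OF sum_u[of j], of "T j"] by (simp add: mult_ac)
  note swap1 = suminf_swap_bounded_kernel[where M = D, OF S_summable v K]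
  note swap2 = suminf_swap_bounded_kernel[where M = D, OF u T_summable K]
  have "Beta x q * Beta (x + d) r = (\<Sum>i. S i * Beta (x + d) r)"
    using sums_mult2[OF S_sums] by (simp add: sums_iff)
  also have "\<dots> = (\<Sum>i. (\<Sum>j. S i * v j * D i j) - (\<Sum>j. u i * T j * D i j))"
  proof (rule suminf_cong)
    fix i
    have "(\<lambda>j. S i * v j * D i j - S i * T j) sums (S i * Beta (d - of_nat i) r - S i * Beta (x + d) r)"
      by (intro sums_diff SvD sums_mult T_sums)
    hence "(\<lambda>j. u i * T j * D i j) sums (S i * Beta (d - of_nat i) r - S i * Beta (x + d) r)"
      by (simp add: split)
    thus "S i * Beta (x + d) r = (\<Sum>j. S i * v j * D i j) - (\<Sum>j. u i * T j * D i j)"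
      using SvD[of i] by (simp add: sums_iff)
  qed
  also have "\<dots> = (\<Sum>i. \<Sum>j. S i * v j * D i j) - (\<Sum>i. \<Sum>j. u i * T j * D i j)"
    by (rule suminf_diff [OF summable_norm_cancel[OF swap1(1)] summable_norm_cancel[OF swap2(1)], symmetric])
  \<comment> \<open>Only this half needs the exchange: its sum over \<open>i\<close> is the one with
    a closed form.\<close>
  also have "(\<Sum>i. \<Sum>j. u i * T j * D i j) = (\<Sum>j. - (T j * Beta (- d - of_nat j) q))"
    using swap2(3) uTD by (simp add: sums_iff)
  also have "\<dots> = - (\<Sum>j. T j * Beta (- d - of_nat j) q)"
  proof (rule suminf_minus)
    show "summable (\<lambda>j. T j * Beta (- d - of_nat j) q)"
      using summable_minus[OF summable_norm_cancel[OF swap2(2)]] sums_unique[OF uTD, symmetric] by simp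
  qed
  also have "(\<Sum>i. \<Sum>j. S i * v j * D i j) = (\<Sum>i. S i * Beta (d - of_nat i) r)"
    using SvD by (simp add: sums_iff)
  finally show "Beta x q * Beta (x + d) r =
          (\<Sum>i. u i * Beta (d - of_nat i) r / (x + of_nat i)) +
          (\<Sum>j. v j * Beta (- d - of_nat j) q / (x + d + of_nat j))"
    by (simp add: S_def T_def)
qed

text \<open>The residues in the product expansion depend on \<open>d\<close>, \<open>q\<close>,
  \<open>r\<close> but not on \<open>x\<close>. Replacing \<open>x\<close> by \<open>x + k\<close>
  therefore only moves the denominators, and summing those against \<open>w k\<close> reassembles a
  Beta function with second argument \<open>s\<close>.\<close>

lemma three_term_Beta_series:
  fixes x d q r s :: complex
  defines "u \<equiv> \<lambda>i. pochhammer (1 - q) i / fact i" and "v \<equiv> \<lambda>j. pochhammer (1 - r) j / fact j"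
    and "w \<equiv> \<lambda>k. pochhammer (1 - s) k / fact k"
  assumes q: "Re q > 1" and r: "Re r > 1" and s: "Re s > 1"
    and d: "d \<notin> \<int>" and x: "x \<notin> \<int>\<^sub>\<le>\<^sub>0" and xd: "x + d \<notin> \<int>\<^sub>\<le>\<^sub>0"
  shows "(\<Sum>k. w k * (Beta (x + of_nat k) q * Beta (x + d + of_nat k) r)) =
          (\<Sum>i. u i * Beta (d - of_nat i) r * Beta (x + of_nat i) s) +
          (\<Sum>j. v j * Beta (- d - of_nat j) q * Beta (x + d + of_nat j) s)"
proof -
  define c where "c = (\<lambda>i. u i * Beta (d - of_nat i) r)"
  define e where "e = (\<lambda>j. v j * Beta (- d - of_nat j) q)"
  have c: "summable (\<lambda>i. norm (c i))" and e: "summable (\<lambda>j. norm (e j))"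
    using Beta_product_partial_fractions(1,2)[OF q r d x xd] by (simp_all add: c_def e_def u_def v_def)
  have w: "summable (\<lambda>k. norm (w k))"
    unfolding w_def by (intro summable_norm_pochhammer_over_fact) (use s in simp)
  \<comment> \<open>Both families of simple fractions are handled at once: \<open>a\<close> is
    \<open>c\<close> or \<open>e\<close>, and \<open>y\<close> is \<open>x\<close> or
    \<open>x + d\<close>.\<close>
  have *: "summable (\<lambda>k. \<Sum>i. w k * a i * (1 / (y + of_nat k + of_nat i)))"
          "(\<Sum>k. \<Sum>i. w k * a i * (1 / (y + of_nat k + of_nat i))) = (\<Sum>i. a i * Beta (y + of_nat i) s)"
          "summable (\<lambda>i. a i / (y + of_nat k + of_nat i))"
    if a: "summable (\<lambda>i. norm (a i))" and y: "y \<notin> \<int>\<^sub>\<le>\<^sub>0" for a y k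
  proof -
    obtain K where K: "\<And>n :: int. norm (1 / (y + of_int n)) \<le> K"
      using inverse_add_int_bounded by blast
    have K': "norm (1 / (y + of_nat k + of_nat i)) \<le> K" for k i
      using K[of "int k + int i"] by (simp add: add_ac)
    note swap = suminf_swap_bounded_kernel[where M = "\<lambda>k i. 1 / (y + of_nat k + of_nat i)", OF w a K']
    show "summable (\<lambda>k. \<Sum>i. w k * a i * (1 / (y + of_nat k + of_nat i)))"
      using swap(1) by (rule summable_norm_cancel)
    have "(\<lambda>k. w k * a i * (1 / (y + of_nat k + of_nat i))) sums (a i * Beta (y + of_nat i) s)" for i
      using sums_mult[OF Beta_series(1)[OF nonpos_Ints_add_of_nat[OF y, of i] s], of "a i"]
      by (simp add: w_def mult_ac add_ac)
    thus "(\<Sum>k. \<Sum>i. w k * a i * (1 / (y + of_nat k + of_nat i))) = (\<Sum>i. a i * Beta (y + of_nat i) s)"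
      unfolding swap(3) by (simp add: sums_iff)
    have "norm (a i / (y + of_nat k + of_nat i)) \<le> norm (a i) * K" for i
      using mult_left_mono[OF K'[of k i], of "norm (a i)"] by (simp add: norm_divide)
    thus "summable (\<lambda>i. a i / (y + of_nat k + of_nat i))"
      by (intro summable_comparison_test'[OF summable_mult2[OF a]])
  qed
  have "w k * (Beta (x + of_nat k) q * Beta (x + d + of_nat k) r) =
          (\<Sum>i. w k * c i * (1 / (x + of_nat k + of_nat i))) +
          (\<Sum>j. w k * e j * (1 / (x + d + of_nat k + of_nat j)))" for k
  proof -
    have "Beta (x + of_nat k) q * Beta (x + of_nat k + d) r =
          (\<Sum>i. c i / (x + of_nat k + of_nat i)) + (\<Sum>j. e j / (x + of_nat k + d + of_nat j))"
      unfolding c_def e_def u_def v_def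
      using nonpos_Ints_add_of_nat[OF x, of k] nonpos_Ints_add_of_nat[OF xd, of k]
      by (intro Beta_product_partial_fractions(3) q r d) (simp_all add: add_ac)
    also have "x + of_nat k + d = x + d + of_nat k" by simp
    finally show ?thesis
      using suminf_mult[OF *(3)[OF c x, of k], of "w k"] suminf_mult[OF *(3)[OF e xd, of k], of "w k"]
      by (simp add: distrib_left)
  qed
  hence "(\<Sum>k. w k * (Beta (x + of_nat k) q * Beta (x + d + of_nat k) r)) =
    (\<Sum>k. (\<Sum>i. w k * c i * (1 / (x + of_nat k + of_nat i))) +
          (\<Sum>j. w k * e j * (1 / (x + d + of_nat k + of_nat j))))" by (simp only:)
  also have "\<dots> = (\<Sum>i. c i * Beta (x + of_nat i) s) + (\<Sum>j. e j * Beta (x + d + of_nat j) s)"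
    using *[OF c x] *[OF e xd] by (simp add: suminf_add [symmetric])
  finally show ?thesis by (simp add: c_def e_def)
qed

subsection \<open>The three-term relation\<close>

lemma Beta_add_of_nat:
  fixes x q :: complex
  assumes "x \<notin> \<int>\<^sub>\<le>\<^sub>0" "x + q \<notin> \<int>\<^sub>\<le>\<^sub>0"
  shows "Beta (x + of_nat n) q = Beta x q * (pochhammer x n / pochhammer (x + q) n)"
  using assms by (simp add: Beta_def pochhammer_Gamma Gamma_eq_zero_iff add_ac)

text \<open>Reversing the product turns the rising factorial of \<open>w - n\<close> into that of
  \<open>1 - w\<close> up to sign. The form with \<open>rGamma\<close> stays valid at the poles of
  \<open>Gamma\<close>.\<close>

lemma rGamma_diff_of_nat:
  fixes w :: complex
  shows "rGamma (w - of_nat n) = (-1) ^ n * pochhammer (1 - w) n * rGamma w"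
  using pochhammer_rGamma[of "w - of_nat n" n] pochhammer_minus'[of "w - 1" n] by simp

text \<open>The signs from \<open>y\<close> and from \<open>y + q\<close> cancel.\<close>

lemma Beta_diff_of_nat:
  fixes y q :: complex
  shows "Beta (y - of_nat n) q = Beta y q * (pochhammer (1 - (y + q)) n / pochhammer (1 - y) n)"
proof -
  have "y - of_nat n + q = (y + q) - of_nat n" by simp
  thus ?thesis
    unfolding Beta_def Gamma_def divide_inverse inverse_inverse_eq
    by (simp only: rGamma_diff_of_nat) (simp add: field_simps flip: power_mult_distrib)
qed

text \<open>The Beta identity is taken at \<open>x = C\<close>, \<open>d = 1 - E\<close>,
  \<open>q = 1 - A\<close>, \<open>r = E - B\<close>, \<open>s = F - C\<close>; the first three
  hypotheses are its real-part conditions. Each sum becomes a Beta prefactor times a hypergeometric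
  series.\<close>

lemma hyp3F2_three_term_relation_restricted:
  fixes A B C E F :: complex
  assumes A: "Re A < 0" and B: "Re (1 + B - E) < 0" and F: "Re (F - C) > 1"
    and E: "E \<notin> \<int>" and C: "C \<notin> \<int>\<^sub>\<le>\<^sub>0" and CE: "C - E + 1 \<notin> \<int>\<^sub>\<le>\<^sub>0"
    and F0: "F \<notin> \<int>\<^sub>\<le>\<^sub>0" and FE: "F - E + 1 \<notin> \<int>\<^sub>\<le>\<^sub>0"
    and CA: "C - A + 1 \<notin> \<int>\<^sub>\<le>\<^sub>0" and CB: "C - B + 1 \<notin> \<int>\<^sub>\<le>\<^sub>0"
  shows "Gamma (1 - E) * rGamma (1 - A) * rGamma (1 - B) * rGamma (C - E + 1) * rGamma F
           * hyp3F2_at_1 A B C E F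
       + Gamma (E - 1) * rGamma (E - A) * rGamma (E - B) * rGamma C * rGamma (F - E + 1)
           * hyp3F2_at_1 (A - E + 1) (B - E + 1) (C - E + 1) (2 - E) (F - E + 1)
       = rGamma (F - C) * rGamma (C - A + 1) * rGamma (C - B + 1)
           * hyp3F2_at_1 C (C - E + 1) (C - F + 1) (C - A + 1) (C - B + 1)"
proof -
  have notZ: "1 - E \<notin> \<int>" "E - 1 \<notin> \<int>" "2 - E \<notin> \<int>"
    using E by (auto dest: Ints_diff[of _ 1] Ints_diff[of 1] Ints_diff[of 2] Ints_add[of _ 1])
  have nonpos: "E \<notin> \<int>\<^sub>\<le>\<^sub>0" "1 - E \<notin> \<int>\<^sub>\<le>\<^sub>0" "E - 1 \<notin> \<int>\<^sub>\<le>\<^sub>0" "2 - E \<notin> \<int>\<^sub>\<le>\<^sub>0"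
    using E notZ nonpos_Ints_Int by blast+
  \<comment> \<open>\<open>Gamma\<close> is 0 exactly at its poles by convention, so these facts say
    that no argument is a pole.\<close>
  have nz: "Gamma (1 - A) \<noteq> 0" "Gamma (E - B) \<noteq> 0" "Gamma (F - C) \<noteq> 0" "Gamma C \<noteq> 0" "Gamma (C - E + 1) \<noteq> 0"
    unfolding Gamma_eq_zero_iff using A B F C CE by (auto elim!: nonpos_Ints_cases simp: complex_eq_iff)
  \<comment> \<open>All three series have the same excess \<open>E + F - A - B - C\<close>, the sum
    of \<open>- A\<close>, \<open>E - B\<close> and \<open>F - C\<close>, each of positive real
    part.\<close>
  have sum: "summable (hyp3F2_term A B C E F)"
    "summable (hyp3F2_term (A - E + 1) (B - E + 1) (C - E + 1) (2 - E) (F - E + 1))"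
    "summable (hyp3F2_term C (C - E + 1) (C - F + 1) (C - A + 1) (C - B + 1))"
    using A B F by (auto intro!: summable_hyp3F2_term nonpos F0 FE CA CB)
  have eqs: "C + (1 - E) = C - E + 1" "1 - (1 - A) = A" "1 - (E - B) = B - E + 1" "1 - (F - C) = C - F + 1"
       "- (1 - E) = E - 1" by simp_all
  have "(\<Sum>k. pochhammer (C - F + 1) k / fact k * (Beta (C + of_nat k) (1 - A) * Beta (C - E + 1 + of_nat k) (E - B))) =
     (\<Sum>i. pochhammer A i / fact i * Beta (1 - E - of_nat i) (E - B) * Beta (C + of_nat i) (F - C)) +
     (\<Sum>j. pochhammer (B - E + 1) j / fact j * Beta (E - 1 - of_nat j) (1 - A) * Beta (C - E + 1 + of_nat j) (F - C))"
    by (rule three_term_Beta_series[of "1 - A" "E - B" "F - C" "1 - E" C, unfolded eqs])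
       (use A B F notZ C CE in auto)
  also have "(\<Sum>k. pochhammer (C - F + 1) k / fact k * (Beta (C + of_nat k) (1 - A) * Beta (C - E + 1 + of_nat k) (E - B))) =
     Beta C (1 - A) * Beta (C - E + 1) (E - B) * hyp3F2_at_1 C (C - E + 1) (C - F + 1) (C - A + 1) (C - B + 1)"
  proof -
    have "C + (1 - A) = C - A + 1" "C - E + 1 + (E - B) = C - B + 1" by simp_all
    hence "Beta (C + of_nat k) (1 - A) = Beta C (1 - A) * (pochhammer C k / pochhammer (C - A + 1) k)"
      "Beta (C - E + 1 + of_nat k) (E - B) =
         Beta (C - E + 1) (E - B) * (pochhammer (C - E + 1) k / pochhammer (C - B + 1) k)" for k
      using Beta_add_of_nat[of C "1 - A" k] Beta_add_of_nat[of "C - E + 1" "E - B" k] C CE CA CB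
      by (simp_all only: not_False_eq_True)
    thus ?thesis
      unfolding hyp3F2_at_1_def using sum(3)
      by (subst suminf_mult [symmetric]) (simp_all add: hyp3F2_term_def mult_ac)
  qed
  also have "(\<Sum>i. pochhammer A i / fact i * Beta (1 - E - of_nat i) (E - B) * Beta (C + of_nat i) (F - C)) =
     Beta (1 - E) (E - B) * Beta C (F - C) * hyp3F2_at_1 A B C E F"
  proof -
    have "1 - (1 - E + (E - B)) = B" "1 - (1 - E) = E" "C + (F - C) = F" by simp_all
    thus ?thesis
      unfolding hyp3F2_at_1_def Beta_diff_of_nat using sum(1) C F0
      by (subst suminf_mult [symmetric]) (simp_all add: Beta_add_of_nat hyp3F2_term_def mult_ac)
  qed
  also have "(\<Sum>j. pochhammer (B - E + 1) j / fact j * Beta (E - 1 - of_nat j) (1 - A) * Beta (C - E + 1 + of_nat j) (F - C)) =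
     Beta (E - 1) (1 - A) * Beta (C - E + 1) (F - C)
       * hyp3F2_at_1 (A - E + 1) (B - E + 1) (C - E + 1) (2 - E) (F - E + 1)"
  proof -
    have "1 - (E - 1 + (1 - A)) = A - E + 1" "1 - (E - 1) = 2 - E" "C - E + 1 + (F - C) = F - E + 1" by simp_all
    hence "Beta (E - 1 - of_nat k) (1 - A) =
         Beta (E - 1) (1 - A) * (pochhammer (A - E + 1) k / pochhammer (2 - E) k)"
      "Beta (C - E + 1 + of_nat k) (F - C) =
         Beta (C - E + 1) (F - C) * (pochhammer (C - E + 1) k / pochhammer (F - E + 1) k)" for k
      using Beta_diff_of_nat[of "E - 1" k "1 - A"] Beta_add_of_nat[of "C - E + 1" "F - C" k] CE FE
      by (simp_all only: not_False_eq_True)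
    thus ?thesis
      unfolding hyp3F2_at_1_def using sum(2)
      by (subst suminf_mult [symmetric]) (simp_all add: hyp3F2_term_def mult_ac)
  qed
  finally have *: "Beta C (1 - A) * Beta (C - E + 1) (E - B) * hyp3F2_at_1 C (C - E + 1) (C - F + 1) (C - A + 1) (C - B + 1) =
     Beta (1 - E) (E - B) * Beta C (F - C) * hyp3F2_at_1 A B C E F +
     Beta (E - 1) (1 - A) * Beta (C - E + 1) (F - C)
       * hyp3F2_at_1 (A - E + 1) (B - E + 1) (C - E + 1) (2 - E) (F - E + 1)" .
  have args: "C + (1 - A) = C - A + 1" "C - E + 1 + (E - B) = C - B + 1" "1 - E + (E - B) = 1 - B"
    "C + (F - C) = F" "E - 1 + (1 - A) = E - A" "C - E + 1 + (F - C) = F - E + 1" by simp_all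
  \<comment> \<open>\<open>P\<close> is the common factor by which the Beta identity exceeds the
    normalised relation.\<close>
  define P where "P = Gamma (1 - A) * Gamma (E - B) * Gamma (F - C) * Gamma C * Gamma (C - E + 1)"
  have rG: "rGamma (1 - A) = 1 / Gamma (1 - A)" "rGamma (E - B) = 1 / Gamma (E - B)"
      "rGamma (F - C) = 1 / Gamma (F - C)" "rGamma C = 1 / Gamma C"
      "rGamma (C - E + 1) = 1 / Gamma (C - E + 1)"
    by (simp_all only: rGamma_inverse_Gamma inverse_eq_divide)
  have Beta_rGamma: "Beta x y = Gamma x * Gamma y * rGamma (x + y)" for x y :: complex
    by (simp only: Beta_def rGamma_inverse_Gamma divide_inverse)
  have "P \<noteq> 0" using nz by (simp add: P_def)
  moreover have "P * (Gamma (1 - E) * rGamma (1 - A) * rGamma (1 - B) * rGamma (C - E + 1) * rGamma F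
           * hyp3F2_at_1 A B C E F
       + Gamma (E - 1) * rGamma (E - A) * rGamma (E - B) * rGamma C * rGamma (F - E + 1)
           * hyp3F2_at_1 (A - E + 1) (B - E + 1) (C - E + 1) (2 - E) (F - E + 1)) =
      Beta (1 - E) (E - B) * Beta C (F - C) * hyp3F2_at_1 A B C E F +
     Beta (E - 1) (1 - A) * Beta (C - E + 1) (F - C)
       * hyp3F2_at_1 (A - E + 1) (B - E + 1) (C - E + 1) (2 - E) (F - E + 1)"
    using nz unfolding P_def Beta_rGamma args rG by (simp add: distrib_left mult_ac)
  moreover have "P * (rGamma (F - C) * rGamma (C - A + 1) * rGamma (C - B + 1)
           * hyp3F2_at_1 C (C - E + 1) (C - F + 1) (C - A + 1) (C - B + 1)) =
       Beta C (1 - A) * Beta (C - E + 1) (E - B) * hyp3F2_at_1 C (C - E + 1) (C - F + 1) (C - A + 1) (C - B + 1)"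
    using nz unfolding P_def Beta_rGamma args rG by (simp add: mult_ac)
  ultimately show ?thesis using * by (metis mult_cancel_left)
qed

section \<open>Analytic continuation in the upper parameters\<close>

text \<open>
  Shifting \<open>A, B, C\<close> simultaneously by \<open>-z\<close> leaves the lower parameters of all three series
  unchanged and raises their parametric excess by \<open>3 z\<close>, so both sides are holomorphic on a
  half-plane. For large \<open>Re z\<close> and \<open>Im z\<close> the restricted relation applies.
\<close>

lemma hyp3F2_three_term_relation:
  fixes A B C E F :: complex
  assumes s: "Re (E + F - A - B - C) > 0" and E: "E \<notin> \<int>"
    and F0: "F \<notin> \<int>\<^sub>\<le>\<^sub>0" and FE: "F - E + 1 \<notin> \<int>\<^sub>\<le>\<^sub>0"
    and CA: "C - A + 1 \<notin> \<int>\<^sub>\<le>\<^sub>0" and CB: "C - B + 1 \<notin> \<int>\<^sub>\<le>\<^sub>0"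
  shows "Gamma (1 - E) * rGamma (1 - A) * rGamma (1 - B) * rGamma (C - E + 1) * rGamma F
           * hyp3F2_at_1 A B C E F
       + Gamma (E - 1) * rGamma (E - A) * rGamma (E - B) * rGamma C * rGamma (F - E + 1)
           * hyp3F2_at_1 (A - E + 1) (B - E + 1) (C - E + 1) (2 - E) (F - E + 1)
       = rGamma (F - C) * rGamma (C - A + 1) * rGamma (C - B + 1)
           * hyp3F2_at_1 C (C - E + 1) (C - F + 1) (C - A + 1) (C - B + 1)"
proof -
  define S where "S = {z. Re (E + F - A - B - C + 3 * z) > 0}"
  \<comment> \<open>\<open>Re z > R\<close> enforces the three real-part conditions after the shift;
    \<open>Im z > R\<close> makes \<open>C - z\<close> and \<open>C - z - E + 1\<close> non-real,
    hence not non-positive integers.\<close>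
  define R where "R = norm A + norm B + norm C + norm E + norm F + 2"
  define U where "U = {z. Re z > R \<and> Im z > R}"
  \<comment> \<open>Outside the series, \<open>z\<close> occurs only inside the entire function
    \<open>rGamma\<close>; the factors with \<open>Gamma\<close> are constant.\<close>
  define f where "f = (\<lambda>z. Gamma (1 - E) * rGamma (1 - (A - z)) * rGamma (1 - (B - z)) * rGamma (C - z - E + 1) * rGamma F
           * hyp3F2_at_1 (A - z) (B - z) (C - z) E F
       + Gamma (E - 1) * rGamma (E - (A - z)) * rGamma (E - (B - z)) * rGamma (C - z) * rGamma (F - E + 1)
           * hyp3F2_at_1 (A - E + 1 - z) (B - E + 1 - z) (C - E + 1 - z) (2 - E) (F - E + 1))"
  define g where "g = (\<lambda>z. rGamma (F - (C - z)) * rGamma (C - A + 1) * rGamma (C - B + 1)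
           * hyp3F2_at_1 (C - z) (C - E + 1 - z) (C - F + 1 - z) (C - A + 1) (C - B + 1))"
  have "2 - E \<notin> \<int>" using E Ints_diff[of 2 "2 - E"] by auto
  hence nonpos: "E \<notin> \<int>\<^sub>\<le>\<^sub>0" "2 - E \<notin> \<int>\<^sub>\<le>\<^sub>0" using E nonpos_Ints_Int by blast+
  have "f 0 = g 0"
  proof (rule analytic_continuation_open[of U S f g])
    show "open U" unfolding U_def
      by (intro open_Collect_conj open_Collect_less continuous_intros)
    show "open S" unfolding S_def
      by (intro open_Collect_less continuous_intros)
    have "Complex (R + 1) (R + 1) \<in> U" by (simp add: U_def)
    thus "U \<noteq> {}" by blast
    have "S = {z. Re z > - Re (E + F - A - B - C) / 3}"
      by (auto simp: S_def field_simps)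
    thus "connected S"
      by (simp only: convex_connected convex_halfspace_Re_gt)
    have *: "\<bar>Re A\<bar> + \<bar>Re B\<bar> + \<bar>Re C\<bar> + \<bar>Re E\<bar> + \<bar>Re F\<bar> + 2 \<le> R"
      "\<bar>Im A\<bar> + \<bar>Im B\<bar> + \<bar>Im C\<bar> + \<bar>Im E\<bar> + \<bar>Im F\<bar> + 2 \<le> R"
      unfolding R_def by (intro add_mono abs_Re_le_cmod abs_Im_le_cmod order_refl)+
    have U: "Re z > \<bar>Re A\<bar> + \<bar>Re B\<bar> + \<bar>Re C\<bar> + \<bar>Re E\<bar> + \<bar>Re F\<bar> + 2"
        "Im z > \<bar>Im A\<bar> + \<bar>Im B\<bar> + \<bar>Im C\<bar> + \<bar>Im E\<bar> + \<bar>Im F\<bar> + 2" if "z \<in> U" for z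
      using that * by (auto simp: U_def)
    have "Re (E + F - A - B - C + 3 * z) > 0" if "z \<in> U" for z
      using U(1)[OF that] by simp
    thus "U \<subseteq> S" by (auto simp: S_def)
    show "f holomorphic_on S"
    proof -
      have "(\<lambda>z. hyp3F2_at_1 (A - z) (B - z) (C - z) E F) holomorphic_on S"
        unfolding S_def by (rule holomorphic_hyp3F2_at_1[OF nonpos(1) F0])
      moreover have "(\<lambda>z. hyp3F2_at_1 (A - E + 1 - z) (B - E + 1 - z) (C - E + 1 - z) (2 - E) (F - E + 1)) holomorphic_on S"
        using holomorphic_hyp3F2_at_1[OF nonpos(2) FE, of "A - E + 1" "B - E + 1" "C - E + 1"]
        by (simp add: S_def algebra_simps)
      ultimately show ?thesis
        unfolding f_def by (intro holomorphic_intros)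
    qed
    show "g holomorphic_on S"
    proof -
      have "(\<lambda>z. hyp3F2_at_1 (C - z) (C - E + 1 - z) (C - F + 1 - z) (C - A + 1) (C - B + 1)) holomorphic_on S"
        using holomorphic_hyp3F2_at_1[OF CA CB, of C "C - E + 1" "C - F + 1"]
        by (simp add: S_def algebra_simps)
      thus ?thesis
        unfolding g_def by (intro holomorphic_intros)
    qed
    show "0 \<in> S" using s by (simp add: S_def)
    fix z assume z: "z \<in> U"
    have "C - z \<notin> \<int>\<^sub>\<le>\<^sub>0" "C - z - E + 1 \<notin> \<int>\<^sub>\<le>\<^sub>0"
      using U(2)[OF z] by (auto elim!: nonpos_Ints_cases simp: complex_eq_iff)
    thus "f z = g z"
      using hyp3F2_three_term_relation_restricted[of "A - z" "B - z" E F "C - z"] U(1)[OF z] E F0 FE CA CB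
      by (simp add: f_def g_def algebra_simps)
  qed
  thus ?thesis by (simp add: f_def g_def)
qed

section \<open>Specialisation to the parameters of the theorem\<close>

theorem corollary3p11:
  fixes a\<^sub>1 a\<^sub>2 a\<^sub>3 b\<^sub>1 b\<^sub>2 b\<^sub>3 \<psi> :: complex and n :: nat
  assumes psi: "\<psi> = (b\<^sub>1 - a\<^sub>1) + (b\<^sub>2 - a\<^sub>2) + (b\<^sub>3 - a\<^sub>3)"
    and "a\<^sub>1 - a\<^sub>3 \<notin> \<int>"
    and "Re (1 - b\<^sub>3 + a\<^sub>2 + of_nat n) > 0"
    and "2 + a\<^sub>1 + a\<^sub>2 - b\<^sub>1 - b\<^sub>2 + of_nat n \<notin> \<int>\<^sub>\<le>\<^sub>0"
    and "2 + a\<^sub>2 + a\<^sub>3 - b\<^sub>1 - b\<^sub>2 + of_nat n \<notin> \<int>\<^sub>\<le>\<^sub>0"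
    and "\<psi> + a\<^sub>2 - b\<^sub>1 \<notin> \<int>\<^sub>\<le>\<^sub>0"
    and "\<psi> + a\<^sub>2 - b\<^sub>2 \<notin> \<int>\<^sub>\<le>\<^sub>0"
  shows "summable (hyp3F2_term (1 + a\<^sub>1 - b\<^sub>1) (1 + a\<^sub>1 - b\<^sub>2) (b\<^sub>3 - a\<^sub>3)
           (1 + a\<^sub>1 - a\<^sub>3) (2 + a\<^sub>1 + a\<^sub>2 - b\<^sub>1 - b\<^sub>2 + of_nat n))
    \<and> summable (hyp3F2_term (1 + a\<^sub>3 - b\<^sub>1) (1 + a\<^sub>3 - b\<^sub>2) (b\<^sub>3 - a\<^sub>1)
           (1 + a\<^sub>3 - a\<^sub>1) (2 + a\<^sub>2 + a\<^sub>3 - b\<^sub>1 - b\<^sub>2 + of_nat n))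
    \<and> summable (hyp3F2_term (b\<^sub>3 - a\<^sub>1) (b\<^sub>3 - a\<^sub>3) (\<psi> - 1 - of_nat n)
           (\<psi> + a\<^sub>2 - b\<^sub>1) (\<psi> + a\<^sub>2 - b\<^sub>2))
    \<and> Gamma (a\<^sub>3 - a\<^sub>1) * rGamma (b\<^sub>1 - a\<^sub>1) * rGamma (b\<^sub>2 - a\<^sub>1) * rGamma (b\<^sub>3 - a\<^sub>1)
             * rGamma (2 + a\<^sub>1 + a\<^sub>2 - b\<^sub>1 - b\<^sub>2 + of_nat n)
             * hyp3F2_at_1 (1 + a\<^sub>1 - b\<^sub>1) (1 + a\<^sub>1 - b\<^sub>2) (b\<^sub>3 - a\<^sub>3)
                 (1 + a\<^sub>1 - a\<^sub>3) (2 + a\<^sub>1 + a\<^sub>2 - b\<^sub>1 - b\<^sub>2 + of_nat n)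
         + Gamma (a\<^sub>1 - a\<^sub>3) * rGamma (b\<^sub>1 - a\<^sub>3) * rGamma (b\<^sub>2 - a\<^sub>3) * rGamma (b\<^sub>3 - a\<^sub>3)
             * rGamma (2 + a\<^sub>2 + a\<^sub>3 - b\<^sub>1 - b\<^sub>2 + of_nat n)
             * hyp3F2_at_1 (1 + a\<^sub>3 - b\<^sub>1) (1 + a\<^sub>3 - b\<^sub>2) (b\<^sub>3 - a\<^sub>1)
                 (1 + a\<^sub>3 - a\<^sub>1) (2 + a\<^sub>2 + a\<^sub>3 - b\<^sub>1 - b\<^sub>2 + of_nat n)
         = rGamma (2 - \<psi> + of_nat n) * rGamma (\<psi> + a\<^sub>2 - b\<^sub>1) * rGamma (\<psi> + a\<^sub>2 - b\<^sub>2)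
             * hyp3F2_at_1 (b\<^sub>3 - a\<^sub>1) (b\<^sub>3 - a\<^sub>3) (\<psi> - 1 - of_nat n)
                 (\<psi> + a\<^sub>2 - b\<^sub>1) (\<psi> + a\<^sub>2 - b\<^sub>2)"
proof -
  define A B C E F where "A = 1 + a\<^sub>1 - b\<^sub>1" and "B = 1 + a\<^sub>1 - b\<^sub>2" and "C = b\<^sub>3 - a\<^sub>3"
    and "E = 1 + a\<^sub>1 - a\<^sub>3" and "F = 2 + a\<^sub>1 + a\<^sub>2 - b\<^sub>1 - b\<^sub>2 + of_nat n"
  note defs = A_def B_def C_def E_def F_def
  have args: "a\<^sub>3 - a\<^sub>1 = 1 - E" "b\<^sub>1 - a\<^sub>1 = 1 - A" "b\<^sub>2 - a\<^sub>1 = 1 - B" "b\<^sub>3 - a\<^sub>1 = C - E + 1"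
      "1 + a\<^sub>1 - b\<^sub>1 = A" "1 + a\<^sub>1 - b\<^sub>2 = B" "b\<^sub>3 - a\<^sub>3 = C" "1 + a\<^sub>1 - a\<^sub>3 = E"
      "2 + a\<^sub>1 + a\<^sub>2 - b\<^sub>1 - b\<^sub>2 + of_nat n = F" "2 + a\<^sub>2 + a\<^sub>3 - b\<^sub>1 - b\<^sub>2 + of_nat n = F - E + 1"
      "a\<^sub>1 - a\<^sub>3 = E - 1" "b\<^sub>1 - a\<^sub>3 = E - A" "b\<^sub>2 - a\<^sub>3 = E - B" "1 + a\<^sub>3 - b\<^sub>1 = A - E + 1"
      "1 + a\<^sub>3 - b\<^sub>2 = B - E + 1" "1 + a\<^sub>3 - a\<^sub>1 = 2 - E" "2 - \<psi> + of_nat n = F - C"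
      "\<psi> - 1 - of_nat n = C - F + 1" "\<psi> + a\<^sub>2 - b\<^sub>1 = C - B + 1" "\<psi> + a\<^sub>2 - b\<^sub>2 = C - A + 1"
      "1 - b\<^sub>3 + a\<^sub>2 + of_nat n = E + F - A - B - C"
    by (simp_all add: defs psi)
  note a = assms(2-7)[unfolded args]
  have "E \<notin> \<int>" using a(1) Ints_diff[of E 1] by auto
  moreover have "2 - E \<notin> \<int>" using \<open>E \<notin> \<int>\<close> Ints_diff[of 2 "2 - E"] by auto
  ultimately have nonpos: "E \<notin> \<int>\<^sub>\<le>\<^sub>0" "2 - E \<notin> \<int>\<^sub>\<le>\<^sub>0" using nonpos_Ints_Int by blast+
  \<comment> \<open>The theorem lists the upper pair \<open>C\<close>, \<open>C - E + 1\<close> and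
    the lower pair \<open>C - A + 1\<close>, \<open>C - B + 1\<close> in the opposite order; for the
    same reason \<open>a(6)\<close> precedes \<open>a(5)\<close> below.\<close>
  have swap: "hyp3F2_term a' b' c' e' f' = hyp3F2_term b' a' c' f' e'" for a' b' c' e' f'
    by (simp add: fun_eq_iff hyp3F2_term_def mult_ac)
  have "summable (hyp3F2_term A B C E F)"
    "summable (hyp3F2_term (A - E + 1) (B - E + 1) (C - E + 1) (2 - E) (F - E + 1))"
    "summable (hyp3F2_term (C - E + 1) C (C - F + 1) (C - B + 1) (C - A + 1))"
    by (intro summable_hyp3F2_term nonpos a; use a(2) in simp)+
  moreover note hyp3F2_three_term_relation[OF a(2) \<open>E \<notin> \<int>\<close> a(3,4,6,5)]
  ultimately show ?thesis
    unfolding args hyp3F2_at_1_def swap[of "C - E + 1"] by (simp add: mult_ac)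
qed

end
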